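(* Let $\mathcal F$ be a normalized notation system with $+$ and $1$. Suppose that $\mathcal F$ is base-change maximal, and that for every $m\in\mathbb N$ there is $i\in\mathbb N$ such that $\mathrm G^{\mathcal F}_i(m)=0$. Then every Goodstein walk for $\mathcal F$ is finite.
   Context: A notation system is a family $\mathcal F$ of function symbols, each $f\in\mathcal F$ equipped with an arity $n_f>0$ and a function $|f|\colon\mathbb N^{n_f}\to\mathbb N$. The first argument of each symbol is regarded as a base. For fixed $k\ge 2$, the set $\mathbb T^{\mathcal F}_k$ of base $k$ terms is defined inductively: if $\tau_1,\ldots,\tau_n\in\mathbb T^{\mathcal F}_k$ and $f\in\mathcal F$ has arity $n+1$, then $f(k,\tau_1,\ldots,\tau_n)\in\mathbb T^{\mathcal F}_k$. The value of a term is $|f(k,\tau_1,\ldots,\tau_n)|=|f|(k,|\tau_1|,\ldots,|\tau_n|)$. "With $+$ and $1$" means that $\mathcal F$ has a symbol of arity 3 with function $(k,x,y)\mapsto x+y$ and a term $1$ not depending on the base (in every base $k\ge 2$ there is a term $1$ with value $1$, and base change sends the base-$k$ term $1$ to the base-$\ell$ term $1$). A normal form assignment is a function $\mathrm{nf}$ assigning to each $k\ge2$ and $n\in\mathbb N$ a term $\mathrm{nf}_k(n)\in\mathbb T^{\mathcal F}_k$ with $|\mathrm{nf}_k(n)|=n$; a normalized notation system is a notation system equipped with one. For $\tau\in\mathbb T^{\mathcal F}_k$, $\mathrm{nf}_k(\tau)=\mathrm{nf}_k(|\tau|)$. For $k\le \ell$ and $\tau\in\mathbb T^{\mathcal F}_k$,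 the base change is $\uparrow^\ell f(k,\tau_1,\ldots,\tau_n)=f(\ell,\uparrow^\ell\tau_1,\ldots,\uparrow^\ell\tau_n)$, and $\uparrow^\ell_k n=|\uparrow^\ell\mathrm{nf}_k(n)|$ for $n\in\mathbb N$. $\mathcal F$ is base-change maximal if for all $k\ge2$, $\tau\in\mathbb T^{\mathcal F}_k$ and $\ell\ge k$, $|\uparrow^\ell\tau|\le|\uparrow^\ell\mathrm{nf}_k(\tau)|$. The $\mathcal F$-Goodstein sequence beginning at $m$ (with initial base $2$) is $\mathrm G^{\mathcal F}_0(m)=m$ and $\mathrm G^{\mathcal F}_{i+1}(m)=\uparrow^{i+3}_{i+2}\mathrm G^{\mathcal F}_i(m)-1$ if $\mathrm G^{\mathcal F}_i(m)>0$; the sequence stops once it reaches $0$. A Goodstein walk for $\mathcal F$ is a sequence $(m_i)_{i<\alpha}$ of natural numbers, where $\alpha\leq\infty$, such that for every $i<\alpha$ there is a term $\tau_i\in\mathbb T^{\mathcal F}_{i+2}$ with $|\tau_i|=m_i$ and, if $i+1<\alpha$, $m_{i+1}=|\uparrow^{i+3}\tau_i|-1$ (ordinary subtraction, so that $|\uparrow^{i+3}\tau_i|\geq1$ in this case). The walk is finite if $\alpha<\infty$. *)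

theory Defs
  imports Main "HOL-Library.Extended_Nat"
begin

text \<open>The function \<open>interp F f\<close> of a symbol \<open>f\<close> is applied only to lists of length \<open>arity F f\<close>;
  the first entry of the list is the base.\<close>

record 'f notation_system =
  symbols :: "'f set"
  arity :: "'f \<Rightarrow> nat"
  interp :: "'f \<Rightarrow> nat list \<Rightarrow> nat"

definition is_notation_system :: "'f notation_system \<Rightarrow> bool" where
  "is_notation_system F \<longleftrightarrow> (\<forall>f\<in>symbols F. arity F f > 0)"

text \<open>\<open>App f k [t\<^sub>1, \<dots>, t\<^sub>n]\<close> stands for \<open>f(k, t\<^sub>1, \<dots>, t\<^sub>n)\<close>, so the arity of \<open>f\<close> is \<open>n + 1\<close>.\<close>

datatype 'f tm = App 'f nat "'f tm list"

inductive_set base_terms :: "'f notation_system \<Rightarrow> nat \<Rightarrow> 'f tm set"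
  for F :: "'f notation_system" and k :: nat where
  App: "f \<in> symbols F \<Longrightarrow> arity F f = length ts + 1 \<Longrightarrow> \<forall>t\<in>set ts. t \<in> base_terms F k
    \<Longrightarrow> App f k ts \<in> base_terms F k"

primrec tm_value :: "'f notation_system \<Rightarrow> 'f tm \<Rightarrow> nat" where
  "tm_value F (App f k ts) = interp F f (k # map (tm_value F) ts)"

primrec base_change :: "nat \<Rightarrow> 'f tm \<Rightarrow> 'f tm" where
  "base_change l (App f k ts) = App f l (map (base_change l) ts)"

definition has_plus :: "'f notation_system \<Rightarrow> bool" where
  "has_plus F \<longleftrightarrow>
    (\<exists>p\<in>symbols F. arity F p = 3 \<and> (\<forall>k x y. interp F p [k, x, y] = x + y))"

text \<open>Terms record their base, so the term \<open>1\<close> is a family with one member for each base, and base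
  change maps its members to one another.\<close>

definition has_one :: "'f notation_system \<Rightarrow> bool" where
  "has_one F \<longleftrightarrow>
    (\<exists>one :: nat \<Rightarrow> 'f tm. \<forall>k\<ge>2. one k \<in> base_terms F k \<and> tm_value F (one k) = 1 \<and>
      (\<forall>l\<ge>k. base_change l (one k) = one l))"

definition normal_form_assignment ::
    "'f notation_system \<Rightarrow> (nat \<Rightarrow> nat \<Rightarrow> 'f tm) \<Rightarrow> bool" where
  "normal_form_assignment F nf \<longleftrightarrow>
    (\<forall>k\<ge>2. \<forall>n. nf k n \<in> base_terms F k \<and> tm_value F (nf k n) = n)"

definition normalized_notation_system ::
    "'f notation_system \<Rightarrow> (nat \<Rightarrow> nat \<Rightarrow> 'f tm) \<Rightarrow> bool" where
  "normalized_notation_system F nf \<longleftrightarrow> is_notation_system F \<and> normal_form_assignment F nf"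

definition base_change_nat ::
    "'f notation_system \<Rightarrow> (nat \<Rightarrow> nat \<Rightarrow> 'f tm) \<Rightarrow> nat \<Rightarrow> nat \<Rightarrow> nat \<Rightarrow> nat" where
  "base_change_nat F nf k l n = tm_value F (base_change l (nf k n))"

definition base_change_maximal ::
    "'f notation_system \<Rightarrow> (nat \<Rightarrow> nat \<Rightarrow> 'f tm) \<Rightarrow> bool" where
  "base_change_maximal F nf \<longleftrightarrow>
    (\<forall>k\<ge>2. \<forall>t\<in>base_terms F k. \<forall>l\<ge>k.
      tm_value F (base_change l t) \<le> tm_value F (base_change l (nf k (tm_value F t))))"

text \<open>\<open>None\<close> means that the sequence has already stopped. The subtraction on \<open>nat\<close> truncates only if
  \<open>base_change_nat\<close> sends a positive number to \<open>0\<close>; this cannot happen if the system is base-change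
  maximal with \<open>+\<close> and \<open>1\<close>, because then \<open>n \<le> base_change_nat F nf k l n\<close>.\<close>

primrec goodstein ::
    "'f notation_system \<Rightarrow> (nat \<Rightarrow> nat \<Rightarrow> 'f tm) \<Rightarrow> nat \<Rightarrow> nat \<Rightarrow> nat option" where
  "goodstein F nf m 0 = Some m"
| "goodstein F nf m (Suc i) =
    (case goodstein F nf m i of
      None \<Rightarrow> None
    | Some g \<Rightarrow> if g > 0 then Some (base_change_nat F nf (i + 2) (i + 3) g - 1) else None)"

text \<open>A walk of length \<open>\<alpha>\<close> is given by the values \<open>m i\<close> with \<open>i < \<alpha>\<close>; the other values of \<open>m\<close> are
  irrelevant.\<close>

definition goodstein_walk :: "'f notation_system \<Rightarrow> enat \<Rightarrow> (nat \<Rightarrow> nat) \<Rightarrow> bool" where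
  "goodstein_walk F \<alpha> m \<longleftrightarrow>
    (\<forall>i. enat i < \<alpha> \<longrightarrow>
      (\<exists>t\<in>base_terms F (i + 2). tm_value F t = m i \<and>
        (enat (i + 1) < \<alpha> \<longrightarrow>
          tm_value F (base_change (i + 3) t) \<ge> 1 \<and>
          m (i + 1) = tm_value F (base_change (i + 3) t) - 1)))"

end

theory Submission
  imports Defs
begin

text \<open>Base-change maximality together with \<open>+\<close> and \<open>1\<close> makes the base change of numbers strictly
  increasing: adding \<open>1\<close> to the normal form of \<open>n\<close> gives a term for \<open>n + 1\<close>, whose base change is one
  more than that of \<open>n\<close>, and the normal form of \<open>n + 1\<close> does at least as well. An infinite walk that
  starts at \<open>m\<^sub>0\<close> is therefore compared with the Goodstein sequence that starts at \<open>m\<^sub>0 + 1\<close>. This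
  sequence remains strictly above the walk, because maximality bounds each step of the walk by the
  base change of its current value and strict monotonicity preserves the gap. Hence it never reaches
  \<open>0\<close>.

  The sequence from \<open>m\<^sub>0\<close> itself would not serve: it stops on reaching \<open>0\<close>, whereas a walk may
  leave \<open>0\<close> again, since a term of value \<open>0\<close> can have a base change of positive value.\<close>

lemma base_change_nat_less_Suc:
  assumes nf: "normal_form_assignment F nf" and plus: "has_plus F" and one: "has_one F"
    and maximal: "base_change_maximal F nf" and "2 \<le> k" "k \<le> l"
  shows "base_change_nat F nf k l n < base_change_nat F nf k l (Suc n)"
proof -
  obtain p where p: "p \<in> symbols F" "arity F p = 3" "\<And>k x y. interp F p [k, x, y] = x + y"
    using plus by (auto simp: has_plus_def)
  obtain one where one: "\<And>k. 2 \<le> k \<Longrightarrow> one k \<in> base_terms F k \<and> tm_value F (one k) = 1"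
    "\<And>k l. 2 \<le> k \<Longrightarrow> k \<le> l \<Longrightarrow> base_change l (one k) = one l"
    using one by (auto simp: has_one_def)
  have nf_n: "nf k n \<in> base_terms F k" "tm_value F (nf k n) = n"
    using nf \<open>2 \<le> k\<close> by (auto simp: normal_form_assignment_def)
  define t where "t = App p k [nf k n, one k]"
  have "t \<in> base_terms F k"
    unfolding t_def using p one(1)[OF \<open>2 \<le> k\<close>] nf_n by (intro base_terms.App) auto
  moreover have "tm_value F t = Suc n"
    using p one(1)[OF \<open>2 \<le> k\<close>] nf_n by (simp add: t_def)
  ultimately have "tm_value F (base_change l t) \<le> base_change_nat F nf k l (Suc n)"
    using maximal \<open>2 \<le> k\<close> \<open>k \<le> l\<close> by (metis base_change_maximal_def base_change_nat_def)
  moreover have "tm_value F (base_change l t) = Suc (base_change_nat F nf k l n)"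
    using p one(1)[of l] one(2)[OF \<open>2 \<le> k\<close> \<open>k \<le> l\<close>] \<open>2 \<le> k\<close> \<open>k \<le> l\<close>
    by (simp add: t_def base_change_nat_def)
  ultimately show ?thesis by simp
qed

lemma strict_mono_base_change_nat:
  assumes "normal_form_assignment F nf" "has_plus F" "has_one F"
    and "base_change_maximal F nf" "2 \<le> k" "k \<le> l"
  shows "strict_mono (base_change_nat F nf k l)"
  using base_change_nat_less_Suc[OF assms] by (simp add: strict_mono_Suc_iff)

text \<open>The hypothesis on \<open>m\<close> does not allow the walk to stop, so each of its steps subtracts \<open>1\<close> from a
  positive number. If \<open>m i < g\<close>, then \<open>m (Suc i) + 1\<close>, being the base change of a term of value
  \<open>m i\<close>, is at most the base change of \<open>m i\<close>, which is less than that of \<open>g\<close>. The gap thus survives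
  the subtraction of \<open>1\<close> from the base change of \<open>g\<close>.\<close>

lemma goodstein_stays_above_infinite_walk:
  assumes nf: "normal_form_assignment F nf" and plus: "has_plus F" and one: "has_one F"
    and maximal: "base_change_maximal F nf"
    and walk: "goodstein_walk F \<infinity> m" and start: "m 0 < n"
  shows "\<exists>g. goodstein F nf n i = Some g \<and> m i < g"
proof (induction i)
  case 0
  show ?case using start by simp
next
  case (Suc i)
  then obtain g where g: "goodstein F nf n i = Some g" "m i < g" by blast
  obtain t where t: "t \<in> base_terms F (i + 2)" "tm_value F t = m i"
    "tm_value F (base_change (i + 3) t) \<ge> 1"
    "m (Suc i) = tm_value F (base_change (i + 3) t) - 1"
    using walk by (auto simp: goodstein_walk_def)
  have "Suc (m (Suc i)) = tm_value F (base_change (i + 3) t)"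
    using t(3,4) by simp
  also have "\<dots> \<le> base_change_nat F nf (i + 2) (i + 3) (m i)"
    using maximal[unfolded base_change_maximal_def, rule_format, of "i + 2" t "i + 3"] t(1,2)
    by (simp add: base_change_nat_def)
  also have "\<dots> < base_change_nat F nf (i + 2) (i + 3) g"
    using strict_mono_base_change_nat[OF nf plus one maximal] g(2) by (simp add: strict_mono_def)
  finally show ?case using g by simp
qed

theorem theorem8p2:
  fixes F :: "'f notation_system" and nf :: "nat \<Rightarrow> nat \<Rightarrow> 'f tm"
  assumes "normalized_notation_system F nf"
    and "has_plus F" and "has_one F"
    and "base_change_maximal F nf"
    and "\<forall>m. \<exists>i. goodstein F nf m i = Some 0"
  shows "\<forall>\<alpha> m. goodstein_walk F \<alpha> m \<longrightarrow> \<alpha> < \<infinity>"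
proof (intro allI impI)
  fix \<alpha> :: enat and m
  assume walk: "goodstein_walk F \<alpha> m"
  have nf: "normal_form_assignment F nf"
    using assms(1) by (simp add: normalized_notation_system_def)
  show "\<alpha> < \<infinity>"
  proof (rule ccontr)
    assume "\<not> \<alpha> < \<infinity>"
    then have "goodstein_walk F \<infinity> m" using walk by simp
    from goodstein_stays_above_infinite_walk[OF nf assms(2-4) this, of "Suc (m 0)"]
    have "goodstein F nf (Suc (m 0)) i \<noteq> Some 0" for i
      by (metis lessI not_less_zero option.inject)
    then show False using assms(5) by blast
  qed
qed

end
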